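(* Suppose that $\chi=\nabla\psi^\star$ for some convex and differentiable function $\psi^\star:\mathbb{E}^\star\to\mathbb{R}$, that $\chi$ takes values in $\mathcal{X}$, and that $\|\chi(\xi)-\chi(\zeta)\|\le L_\chi\|\xi-\zeta\|_\star$ for all $\xi,\zeta\in\mathbb{E}^\star$. Let $\{\gamma_k\}_{k=0}^\infty$ satisfy $\gamma_0=1$, $\gamma_k\ge1$ and $$\gamma_k^2-\gamma_{k-1}^2-\gamma_k\le 0,\qquad k=1,2,\dots$$ Assume that $f$ is $L_f$-smooth, i.e. $\|\nabla f(x)-\nabla f(y)\|_\star\le L_f\|x-y\|$ for all $x,y$ in the domain of $f$, and that the learning rate $h>0$ satisfies $$h\le\frac{1}{L_fL_\chi}.$$ Let $x^\star$ be a minimizer of $f$ over $\mathcal{X}$, let $\zeta^\star\in\mathbb{E}^\star$ satisfy $\chi(\zeta^\star)=x^\star$, and define for $k=0,1,\dots$ $$V_k(x_k,\zeta_k)=(\gamma_k^2-\gamma_k)h\big(f(x_k)-f(x^\star)\big)+D_{\psi^\star}(\zeta_k,\zeta^\star).$$ Then, along trajectories $(x_k,\zeta_k)$ generated by the AMD algorithm, $$V_{k+1}(x_{k+1},\zeta_{k+1})\le V_k(x_k,\zeta_k),\qquad k=0,1,\dots$$ and therefore $$(\gamma_k^2-\gamma_k)h\big(f(x_k)-f(x^\star)\big)\le D_{\psi^\star}(\zeta_0,\zeta^\star),\qquad k=0,1,\dots$$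
   Context: $\mathbb{E}$ denotes $\mathbb{R}^d$ with an arbitrary norm $\|\cdot\|$, $\mathbb{E}^\star$ is its dual with dual norm $\|\cdot\|_\star$, and $\langle\zeta,x\rangle=\sum_j\zeta_jx_j$ is the pairing between $\zeta\in\mathbb{E}^\star$ and $x\in\mathbb{E}$. The set $\mathcal{X}\subseteq\mathbb{R}^d$ is non-empty, closed and convex; $f$ is a real-valued function that is convex and continuously differentiable in an open set containing $\mathcal{X}$; $\nabla f(x)\in\mathbb{E}^\star$. Bregman divergence: for $\xi,\zeta\in\mathbb{E}^\star$, $D_{\psi^\star}(\xi,\zeta)=\psi^\star(\xi)-\psi^\star(\zeta)-\langle\xi-\zeta,\nabla\psi^\star(\zeta)\rangle$. AMD (Accelerated Mirror Descent): given $h>0$, $\{\gamma_k\}$, $x_0\in\mathcal{X}$, $\zeta_0\in\mathbb{E}^\star$, for $k=0,1,\dots$: $$y_k=x_k+\tfrac1{\gamma_k}(\chi(\zeta_k)-x_k),\quad \zeta_{k+1}=\zeta_k-\gamma_k h\nabla f(y_k),\quad x_{k+1}=y_k+\tfrac1{\gamma_k}\big(\chi(\zeta_{k+1})-\chi(\zeta_k)\big).$$ *)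

theory Defs
  imports "HOL-Analysis.Analysis"
begin

definition is_norm :: "('a::real_vector \<Rightarrow> real) \<Rightarrow> bool" where
  "is_norm N \<longleftrightarrow>
     (\<forall>x. 0 \<le> N x) \<and> (\<forall>x. N x = 0 \<longleftrightarrow> x = 0) \<and>
     (\<forall>c x. N (c *\<^sub>R x) = \<bar>c\<bar> * N x) \<and>
     (\<forall>x y. N (x + y) \<le> N x + N y)"

(* The dual of (R^d, N) is identified with R^d through the pairing <zeta, x> = zeta \<bullet> x.
   If N is a norm on a Euclidean space, the supremum is over a non-empty set that is
   bounded above. *)
definition dual_norm :: "('a::real_inner \<Rightarrow> real) \<Rightarrow> 'a \<Rightarrow> real" where
  "dual_norm N \<zeta> = (SUP x\<in>{x. N x \<le> 1}. \<zeta> \<bullet> x)"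

(* Unspecified where f is not differentiable. *)
definition grad :: "('a::euclidean_space \<Rightarrow> real) \<Rightarrow> 'a \<Rightarrow> 'a" where
  "grad f x = (THE D. GDERIV f x :> D)"

lemma GDERIV_unique:
  fixes f :: "'a::euclidean_space \<Rightarrow> real"
  assumes "GDERIV f x :> D" "GDERIV f x :> D'"
  shows "D = D'"
proof -
  have "(\<lambda>h. h \<bullet> D) = (\<lambda>h. h \<bullet> D')"
    using assms unfolding gderiv_def by (rule has_derivative_unique)
  then show ?thesis
    by (simp add: fun_eq_iff vector_eq_ldot)
qed

lemma GDERIV_grad:
  fixes f :: "'a::euclidean_space \<Rightarrow> real"
  assumes "f differentiable (at x)"
  shows "GDERIV f x :> grad f x"
proof -
  obtain F where F: "(f has_derivative F) (at x)"
    using assms by (auto simp: differentiable_def)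
  then have lin: "linear F"
    by (rule has_derivative_linear)
  have "F v = v \<bullet> adjoint F 1" for v
    using adjoint_works[OF lin, of v 1] by simp
  then have "F = (\<lambda>v. v \<bullet> adjoint F 1)"
    by (rule ext)
  with F have D: "GDERIV f x :> adjoint F 1"
    unfolding gderiv_def by metis
  show ?thesis
    unfolding grad_def
  proof (rule theI)
    show "GDERIV f x :> adjoint F 1"
      by (rule D)
    show "D' = adjoint F 1" if "GDERIV f x :> D'" for D'
      using that D by (rule GDERIV_unique)
  qed
qed

definition bregman :: "('a::euclidean_space \<Rightarrow> real) \<Rightarrow> 'a \<Rightarrow> 'a \<Rightarrow> real" where
  "bregman \<psi> \<xi> \<zeta> = \<psi> \<xi> - \<psi> \<zeta> - (\<xi> - \<zeta>) \<bullet> grad \<psi> \<zeta>"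

(* Trajectories of accelerated mirror descent with gradient field g and mirror map chi;
   the initial values x 0 and \<zeta> 0 are free. *)
definition AMD_trajectory ::
  "('a::real_vector \<Rightarrow> 'a) \<Rightarrow> ('a \<Rightarrow> 'a) \<Rightarrow> real \<Rightarrow> (nat \<Rightarrow> real) \<Rightarrow>
   (nat \<Rightarrow> 'a) \<Rightarrow> (nat \<Rightarrow> 'a) \<Rightarrow> (nat \<Rightarrow> 'a) \<Rightarrow> bool" where
  "AMD_trajectory g chi h \<gamma> x y \<zeta> \<longleftrightarrow>
     (\<forall>k. y k = x k + (1 / \<gamma> k) *\<^sub>R (chi (\<zeta> k) - x k) \<and>
          \<zeta> (Suc k) = \<zeta> k - (\<gamma> k * h) *\<^sub>R g (y k) \<and>
          x (Suc k) = y k + (1 / \<gamma> k) *\<^sub>R (chi (\<zeta> (Suc k)) - chi (\<zeta> k)))"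

definition lyapunov ::
  "('a::euclidean_space \<Rightarrow> real) \<Rightarrow> ('a \<Rightarrow> real) \<Rightarrow> real \<Rightarrow> (nat \<Rightarrow> real) \<Rightarrow>
   'a \<Rightarrow> 'a \<Rightarrow> nat \<Rightarrow> 'a \<Rightarrow> 'a \<Rightarrow> real" where
  "lyapunov f \<psi> h \<gamma> xstar \<zeta>star k x \<zeta> =
     ((\<gamma> k)\<^sup>2 - \<gamma> k) * h * (f x - f xstar) + bregman \<psi> \<zeta> \<zeta>star"

end

theory Submission
  imports Defs
begin

text \<open>
  Write \<open>z\<close>, \<open>z'\<close> for two consecutive mirror points \<open>chi (\<zeta> k)\<close>, \<open>chi (\<zeta> (Suc k))\<close>, and \<open>g\<close> for
  the gradient of \<open>f\<close> at \<open>y\<close>. The decrease of the Lyapunov function is a balance of two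
  quadratic terms in \<open>N (z' - z)\<close>.

  On the dual side, a Lipschitz gradient makes the convex function \<open>\<psi>\<close> exceed its tangent
  planes by a multiple of the squared difference of the gradients
  (\<open>convex_Lipschitz_gradient_gap\<close>). Since \<open>\<zeta> (Suc k) - \<zeta> k = -\<gamma> h g\<close>, this says that the
  Bregman divergence to \<open>\<zeta>star\<close> changes by at most \<open>-\<gamma> h \<langle>g, z' - xstar\<rangle>\<close> minus
  \<open>(N (z' - z))\<^sup>2 / (2 L_chi)\<close>.

  On the primal side, \<open>x' = (1 - 1/\<gamma>) x + (1/\<gamma>) z'\<close> and \<open>x' - y = (1/\<gamma>) (z' - z)\<close>. The first
  identity gives
  \<open>\<gamma> (z' - xstar) = \<gamma>\<^sup>2 (x' - y) + (\<gamma>\<^sup>2 - \<gamma>) (y - x) + \<gamma> (y - xstar)\<close>. The smoothness of \<open>f\<close>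
  bounds \<open>g\<close> against the first summand from below, at a price of \<open>L_f (N (z' - z))\<^sup>2 / 2\<close>
  because the factor \<open>\<gamma>\<^sup>2\<close> cancels; the convexity of \<open>f\<close> handles the other two
  (\<open>linear_coupling_bound\<close>). Multiplied by \<open>h\<close>, the price is covered by the gain on the
  dual side because \<open>h L_f L_chi \<le> 1\<close>. What is left is
  \<open>\<gamma>\<^sup>2 h (f x' - f xstar) - (\<gamma>\<^sup>2 - \<gamma>) h (f x - f xstar)\<close>, and the condition on the weights
  \<open>\<gamma>\<close> makes this telescope, as \<open>f x' \<ge> f xstar\<close>.

  The norm is arbitrary, so the gap inequality needs a dual vector that attains
  \<open>N (chi \<xi> - chi \<eta>)\<close>; it comes from a supporting hyperplane of the norm ball.
\<close>

section \<open>Norms on a Euclidean space and their duals\<close>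

lemma is_norm_minus:
  assumes "is_norm N"
  shows "N (- x) = N x"
proof -
  have "N ((-1) *\<^sub>R x) = \<bar>-1\<bar> * N x"
    using assms unfolding is_norm_def by blast
  then show ?thesis by simp
qed

lemma is_norm_convex:
  assumes "is_norm N"
  shows "convex_on UNIV N"
proof (rule convex_onI)
  fix t :: real and x y
  assume "0 < t" "t < 1"
  have "N ((1 - t) *\<^sub>R x + t *\<^sub>R y) \<le> N ((1 - t) *\<^sub>R x) + N (t *\<^sub>R y)"
    using assms unfolding is_norm_def by blast
  also have "\<dots> = \<bar>1 - t\<bar> * N x + \<bar>t\<bar> * N y"
    using assms unfolding is_norm_def by metis
  finally show "N ((1 - t) *\<^sub>R x + t *\<^sub>R y) \<le> (1 - t) * N x + t * N y"
    using \<open>0 < t\<close> \<open>t < 1\<close> by simp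
qed simp

text \<open>A convex function on a Euclidean space is continuous, so the norm has a positive
  minimum on the compact unit sphere. This makes the supremum in the dual norm finite.\<close>

lemma is_norm_ge_norm:
  fixes N :: "'a::euclidean_space \<Rightarrow> real"
  assumes "is_norm N"
  obtains c where "c > 0" "\<And>x. c * norm x \<le> N x"
proof -
  have scale: "N (a *\<^sub>R x) = \<bar>a\<bar> * N x" and nonneg: "0 \<le> N x"
    and zero: "N x = 0 \<longleftrightarrow> x = 0" for a x
    using assms unfolding is_norm_def by blast+
  have "continuous_on UNIV N"
    by (rule convex_on_continuous[OF open_UNIV is_norm_convex[OF assms]])
  then have cont: "continuous_on (sphere 0 1) N"
    by (rule continuous_on_subset) simp
  obtain s :: 'a where s: "s \<in> sphere 0 1" "\<forall>x\<in>sphere 0 1. N s \<le> N x"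
    using continuous_attains_inf[OF compact_sphere _ cont] by auto
  have "s \<noteq> 0"
    using s(1) by auto
  then have "N s > 0"
    using nonneg[of s] zero[of s] by linarith
  moreover have "N s * norm x \<le> N x" for x
  proof (cases "x = 0")
    case False
    have "N s \<le> N ((1 / norm x) *\<^sub>R x)"
      using s(2) False by simp
    also have "\<dots> = N x / norm x"
      by (simp add: scale)
    finally show ?thesis
      using False by (simp add: field_simps)
  qed (simp add: nonneg)
  ultimately show ?thesis
    by (rule that)
qed

lemma inner_le_dual_norm:
  fixes N :: "'a::euclidean_space \<Rightarrow> real"
  assumes "is_norm N"
  shows "\<zeta> \<bullet> x \<le> dual_norm N \<zeta> * N x"
proof -
  have scale: "N (a *\<^sub>R x) = \<bar>a\<bar> * N x" and nonneg: "0 \<le> N x"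
    and zero: "N x = 0 \<longleftrightarrow> x = 0" for a x
    using assms unfolding is_norm_def by blast+
  obtain c where c: "c > 0" "\<And>x. c * norm x \<le> N x"
    using is_norm_ge_norm[OF assms] by metis
  have bdd: "bdd_above ((\<lambda>x. \<zeta> \<bullet> x) ` {x. N x \<le> 1})"
  proof (rule bdd_aboveI2)
    fix x assume "x \<in> {x. N x \<le> 1}"
    then have "c * norm x \<le> 1"
      using c(2)[of x] by simp
    then have "norm x \<le> 1 / c"
      using c(1) by (simp add: field_simps)
    then have "norm \<zeta> * norm x \<le> norm \<zeta> * (1 / c)"
      by (rule mult_left_mono) simp
    then show "\<zeta> \<bullet> x \<le> norm \<zeta> * (1 / c)"
      using norm_cauchy_schwarz[of \<zeta> x] by linarith
  qed
  show ?thesis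
  proof (cases "x = 0")
    case True
    then show ?thesis using zero[of 0] by simp
  next
    case False
    then have pos: "N x > 0"
      using nonneg[of x] zero[of x] by linarith
    then have "(1 / N x) *\<^sub>R x \<in> {x. N x \<le> 1}"
      by (simp add: scale)
    then have "\<zeta> \<bullet> ((1 / N x) *\<^sub>R x) \<le> dual_norm N \<zeta>"
      unfolding dual_norm_def by (rule cSUP_upper[OF _ bdd])
    then show ?thesis
      using pos by (simp add: field_simps)
  qed
qed

lemma dual_norm_le:
  assumes "is_norm N" and "0 \<le> c" and "\<And>x. \<zeta> \<bullet> x \<le> c * N x"
  shows "dual_norm N \<zeta> \<le> c"
  unfolding dual_norm_def
proof (rule cSUP_least)
  have "N 0 = 0"
    using assms(1) unfolding is_norm_def by blast
  then have "0 \<in> {x. N x \<le> 1}"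
    by simp
  then show "{x. N x \<le> 1} \<noteq> {}"
    by blast
  fix x assume "x \<in> {x. N x \<le> 1}"
  then have "c * N x \<le> c * 1"
    using \<open>0 \<le> c\<close> by (intro mult_left_mono) auto
  then show "\<zeta> \<bullet> x \<le> c"
    using assms(3)[of x] by linarith
qed

text \<open>The finite-dimensional Hahn-Banach theorem: a hyperplane that separates \<open>p\<close> from the open
  norm ball through \<open>p\<close>, suitably rescaled, is a norming functional.\<close>

lemma norming_functional:
  fixes N :: "'a::euclidean_space \<Rightarrow> real"
  assumes "is_norm N"
  obtains w where "w \<bullet> p = N p" "\<And>u. w \<bullet> u \<le> N u"
proof (cases "p = 0")
  case True
  show ?thesis
    by (rule that[of 0]) (use assms True in \<open>auto simp: is_norm_def\<close>)
next
  case False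
  have scale: "N (a *\<^sub>R x) = \<bar>a\<bar> * N x" and nonneg: "0 \<le> N x"
    and zero: "N x = 0 \<longleftrightarrow> x = 0" for a x
    using assms unfolding is_norm_def by blast+
  define r where "r = N p"
  have r: "r > 0"
    using nonneg[of p] zero[of p] False unfolding r_def by linarith
  define S where "S = (\<lambda>u. p - u) ` {u. N u < r}"
  have "convex {u. N u < r}"
    unfolding convex_alt
  proof (intro ballI allI impI)
    fix u v :: 'a and t :: real
    assume "u \<in> {u. N u < r}" "v \<in> {u. N u < r}" "0 \<le> t \<and> t \<le> 1"
    then show "(1 - t) *\<^sub>R u + t *\<^sub>R v \<in> {u. N u < r}"
      using convex_onD[OF is_norm_convex[OF assms], of t u v]
        convex_bound_lt[of "N u" r "N v" "1 - t" t] by simp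
  qed
  then have "convex S"
    using convex_affinity[of _ p "-1"] unfolding S_def by simp
  moreover have "0 \<notin> S"
    unfolding S_def r_def by auto
  ultimately obtain a where a: "a \<noteq> 0" "\<forall>x\<in>S. 0 \<le> a \<bullet> x"
    using separating_hyperplane_set_0[of S] by auto
  have sep: "a \<bullet> u \<le> a \<bullet> p" if "N u < r" for u
    using a(2) that unfolding S_def by (auto simp: inner_diff_right)
  have bound: "a \<bullet> u * r \<le> a \<bullet> p * N u" for u
  proof (cases "u = 0")
    case False
    then have pos: "N u > 0"
      using nonneg[of u] zero[of u] by linarith
    \<comment> \<open>Rescaling \<open>u\<close> to norm \<open>e * r\<close> puts it in the open ball; then \<open>e\<close> tends to 1.\<close>
    have "a \<bullet> u * r / N u \<le> a \<bullet> p"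
    proof (rule field_le_mult_one_interval)
      fix e :: real assume e: "0 < e" "e < 1"
      have "N ((e * r / N u) *\<^sub>R u) = e * r"
        using pos e r by (simp add: scale)
      also have "\<dots> < r"
        using e r by simp
      finally show "e * (a \<bullet> u * r / N u) \<le> a \<bullet> p"
        using sep[of "(e * r / N u) *\<^sub>R u"] by (simp add: mult_ac)
    qed
    then show ?thesis
      using pos by (simp add: field_simps)
  qed (use zero[of 0] in simp)
  have "a \<bullet> a * r > 0"
    using a(1) r by simp
  then have "a \<bullet> p * N a > 0"
    using bound[of a] by linarith
  then have ap: "a \<bullet> p > 0"
    using nonneg[of a] by (simp add: zero_less_mult_iff)
  show ?thesis
  proof (rule that[of "(r / (a \<bullet> p)) *\<^sub>R a"])
    show "((r / (a \<bullet> p)) *\<^sub>R a) \<bullet> p = N p"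
      using ap by (simp add: r_def)
    show "((r / (a \<bullet> p)) *\<^sub>R a) \<bullet> u \<le> N u" for u
      using bound[of u] ap by (simp add: field_simps)
  qed
qed

section \<open>Convexity and smoothness inequalities\<close>

lemma GDERIV_along_line:
  assumes "GDERIV f (u + t *\<^sub>R d) :> D"
  shows "((\<lambda>t. f (u + t *\<^sub>R d)) has_real_derivative D \<bullet> d) (at t)"
proof -
  have "((\<lambda>t. u + t *\<^sub>R d) has_derivative (\<lambda>s. s *\<^sub>R d)) (at t)"
    by (auto intro!: derivative_eq_intros)
  moreover have "(f has_derivative (\<lambda>v. v \<bullet> D)) (at (u + t *\<^sub>R d))"
    using assms by (simp add: gderiv_def)
  ultimately have "((\<lambda>t. f (u + t *\<^sub>R d)) has_derivative (\<lambda>s. (s *\<^sub>R d) \<bullet> D)) (at t)"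
    by (rule has_derivative_compose)
  moreover have "(\<lambda>s. (s *\<^sub>R d) \<bullet> D) = (*) (D \<bullet> d)"
    by (auto simp: inner_commute)
  ultimately show ?thesis
    by (simp add: has_field_derivative_def)
qed

lemma convex_on_above_tangent:
  fixes f :: "'a::euclidean_space \<Rightarrow> real"
  assumes "convex_on U f" "open U" "u \<in> U" "v \<in> U" "GDERIV f u :> D"
  shows "f u + D \<bullet> (v - u) \<le> f v"
proof -
  define l where "l t = u + t *\<^sub>R (v - u)" for t :: real
  define A where "A = l -` U"
  have l_affine: "l ((1 - t) * r + t * s) = (1 - t) *\<^sub>R l r + t *\<^sub>R l s" for r s t
    unfolding l_def by (simp add: algebra_simps)
  have "convex U"
    using assms(1) by (rule convex_on_imp_convex)
  have convA: "convex A"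
    unfolding convex_alt
  proof (intro ballI allI impI)
    fix r s t :: real assume "r \<in> A" "s \<in> A" "0 \<le> t \<and> t \<le> 1"
    then show "(1 - t) *\<^sub>R r + t *\<^sub>R s \<in> A"
      using \<open>convex U\<close> unfolding A_def convex_alt by (simp add: l_affine)
  qed
  have "convex_on A (\<lambda>t. f (l t))"
  proof (rule convex_onI[OF _ convA])
    fix t r s :: real assume "0 < t" "t < 1" "r \<in> A" "s \<in> A"
    then show "f (l ((1 - t) *\<^sub>R r + t *\<^sub>R s)) \<le> (1 - t) * f (l r) + t * f (l s)"
      using convex_onD[OF assms(1), of t "l r" "l s"] by (simp add: l_affine A_def)
  qed
  moreover have "open A"
    unfolding A_def l_def
    by (intro open_vimage assms(2) continuous_intros)
  then have "0 \<in> interior A"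
    using assms(3) by (simp add: interior_open A_def l_def)
  moreover have "1 \<in> A"
    using assms(4) by (simp add: A_def l_def)
  moreover have "((\<lambda>t. f (l t)) has_real_derivative D \<bullet> (v - u)) (at 0 within A)"
    unfolding l_def
    by (rule has_field_derivative_at_within, rule GDERIV_along_line) (simp add: assms(5))
  ultimately have "f (l 1) - f (l 0) \<ge> D \<bullet> (v - u) * (1 - 0)"
    by (rule convex_on_imp_above_tangent[OF _ convex_connected[OF convA]])
  then show ?thesis
    by (simp add: l_def)
qed

text \<open>The growth condition is stated only along the segment and with the pairing already
  estimated, so that the lemma serves both for a function on the primal space and for one on
  the dual space, each with its own norm.\<close>

lemma descent_along_segment:
  fixes f :: "'a::euclidean_space \<Rightarrow> real"
  assumes deriv: "\<And>t. 0 \<le> t \<Longrightarrow> t \<le> 1 \<Longrightarrow> GDERIV f (u + t *\<^sub>R d) :> G (u + t *\<^sub>R d)"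
    and growth: "\<And>t. 0 \<le> t \<Longrightarrow> t \<le> 1 \<Longrightarrow> (G (u + t *\<^sub>R d) - G u) \<bullet> d \<le> M * t"
  shows "f (u + d) \<le> f u + G u \<bullet> d + M / 2"
proof -
  define \<phi> where "\<phi> t = f (u + t *\<^sub>R d) - t * (G u \<bullet> d) - M / 2 * t\<^sup>2" for t
  have "\<phi> 1 \<le> \<phi> 0"
  proof (rule DERIV_nonpos_imp_nonincreasing[where f = \<phi>])
    fix t :: real assume t: "0 \<le> t" "t \<le> 1"
    have "(\<phi> has_real_derivative G (u + t *\<^sub>R d) \<bullet> d - G u \<bullet> d - M * t) (at t)"
      unfolding \<phi>_def
      by (auto intro!: derivative_eq_intros GDERIV_along_line[OF deriv[OF t]])
    moreover have "G (u + t *\<^sub>R d) \<bullet> d - G u \<bullet> d - M * t \<le> 0"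
      using growth[OF t] by (simp add: inner_diff_left)
    ultimately show "\<exists>y. (\<phi> has_real_derivative y) (at t) \<and> y \<le> 0"
      by blast
  qed simp
  then show ?thesis
    by (simp add: \<phi>_def)
qed

lemma descent_smooth:
  fixes f :: "'a::euclidean_space \<Rightarrow> real"
  assumes N: "is_norm N" and "convex U" "u \<in> U" "v \<in> U"
    and deriv: "\<And>z. z \<in> U \<Longrightarrow> GDERIV f z :> G z"
    and smooth: "\<And>a b. a \<in> U \<Longrightarrow> b \<in> U \<Longrightarrow> dual_norm N (G a - G b) \<le> L * N (a - b)"
  shows "f v \<le> f u + G u \<bullet> (v - u) + L / 2 * (N (v - u))\<^sup>2"
proof -
  define d where "d = v - u"
  have in_U: "u + t *\<^sub>R d \<in> U" if "0 \<le> t" "t \<le> 1" for t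
  proof -
    have "(1 - t) *\<^sub>R u + t *\<^sub>R v \<in> U"
      using \<open>convex U\<close> \<open>u \<in> U\<close> \<open>v \<in> U\<close> that unfolding convex_alt by blast
    then show ?thesis
      by (simp add: d_def algebra_simps)
  qed
  have "f (u + d) \<le> f u + G u \<bullet> d + L * (N d)\<^sup>2 / 2"
  proof (rule descent_along_segment)
    fix t :: real assume t: "0 \<le> t" "t \<le> 1"
    show "GDERIV f (u + t *\<^sub>R d) :> G (u + t *\<^sub>R d)"
      by (rule deriv[OF in_U[OF t]])
    have scale: "N (t *\<^sub>R d) = t * N d" and nonneg: "0 \<le> N d"
      using N t unfolding is_norm_def by auto
    have "(G (u + t *\<^sub>R d) - G u) \<bullet> d \<le> dual_norm N (G (u + t *\<^sub>R d) - G u) * N d"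
      by (rule inner_le_dual_norm[OF N])
    also have "\<dots> \<le> L * N (t *\<^sub>R d) * N d"
      using smooth[OF in_U[OF t] \<open>u \<in> U\<close>] nonneg by (intro mult_right_mono) simp_all
    also have "\<dots> = L * (N d)\<^sup>2 * t"
      by (simp add: scale power2_eq_square)
    finally show "(G (u + t *\<^sub>R d) - G u) \<bullet> d \<le> L * (N d)\<^sup>2 * t" .
  qed
  then show ?thesis
    by (simp add: d_def)
qed

text \<open>The tangent plane at \<open>b\<close> lies below \<open>\<psi>\<close> at every point. Compare the two at the point that a
  gradient step from \<open>a\<close> on \<open>\<psi>\<close> minus this plane reaches: the descent inequality says that the
  step lowers the difference by \<open>(N (G a - G b))\<^sup>2 / (2 * L)\<close>, and it stays nonnegative. The
  direction of steepest descent for the dual norm is a norming functional of \<open>G a - G b\<close>.\<close>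

lemma convex_Lipschitz_gradient_gap:
  fixes \<psi> :: "'a::euclidean_space \<Rightarrow> real"
  assumes N: "is_norm N" and conv: "convex_on UNIV \<psi>"
    and deriv: "\<And>\<xi>. GDERIV \<psi> \<xi> :> G \<xi>" and "0 < L"
    and Lip: "\<And>\<xi> \<eta>. N (G \<xi> - G \<eta>) \<le> L * dual_norm N (\<xi> - \<eta>)"
  shows "\<psi> b + G b \<bullet> (a - b) + (N (G a - G b))\<^sup>2 / (2 * L) \<le> \<psi> a"
proof -
  obtain w where w: "w \<bullet> (G a - G b) = N (G a - G b)" "\<And>u. w \<bullet> u \<le> N u"
    using norming_functional[OF N] by metis
  \<comment> \<open>This step length minimizes the upper bound of the descent inequality.\<close>
  define s where "s = N (G a - G b) / L"
  have "0 \<le> N (G a - G b)"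
    using N unfolding is_norm_def by blast
  then have s: "0 \<le> s"
    using \<open>0 < L\<close> by (simp add: s_def)
  define d where "d = - (s *\<^sub>R w)"
  have dual: "dual_norm N (t *\<^sub>R d) \<le> s * t" if "0 \<le> t" for t
  proof (rule dual_norm_le[OF N])
    show "0 \<le> s * t"
      using s that by simp
    fix u
    have "(t *\<^sub>R d) \<bullet> u = s * t * (w \<bullet> (- u))"
      by (simp add: d_def)
    also have "\<dots> \<le> s * t * N (- u)"
      using s that by (intro mult_left_mono w(2)) simp
    finally show "(t *\<^sub>R d) \<bullet> u \<le> s * t * N u"
      by (simp add: is_norm_minus[OF N])
  qed
  have upper: "\<psi> (a + d) \<le> \<psi> a + G a \<bullet> d + L * s\<^sup>2 / 2"
  proof (rule descent_along_segment[OF deriv])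
    fix t :: real assume t: "0 \<le> t" "t \<le> 1"
    let ?v = "G (a + t *\<^sub>R d) - G a"
    have "?v \<bullet> d = s * (w \<bullet> (- ?v))"
      by (simp add: d_def inner_commute inner_diff_right algebra_simps)
    also have "\<dots> \<le> s * N (- ?v)"
      by (rule mult_left_mono[OF w(2) s])
    also have "\<dots> = s * N ?v"
      by (simp only: is_norm_minus[OF N])
    also have "\<dots> \<le> s * (L * (s * t))"
    proof (rule mult_left_mono[OF _ s])
      have "N ?v \<le> L * dual_norm N (t *\<^sub>R d)"
        using Lip[of "a + t *\<^sub>R d" a] by simp
      also have "\<dots> \<le> L * (s * t)"
        using dual t \<open>0 < L\<close> by (intro mult_left_mono) auto
      finally show "N ?v \<le> L * (s * t)" .
    qed
    finally show "?v \<bullet> d \<le> L * s\<^sup>2 * t"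
      by (simp add: power2_eq_square mult_ac)
  qed
  have lower: "\<psi> b + G b \<bullet> (a + d - b) \<le> \<psi> (a + d)"
    by (rule convex_on_above_tangent[OF conv open_UNIV _ _ deriv]) auto
  have "G b \<bullet> (a + d - b) = G b \<bullet> (a - b) + G b \<bullet> d"
    by (simp add: inner_add_right inner_diff_right)
  moreover have "G a \<bullet> d - G b \<bullet> d = - (s * (w \<bullet> (G a - G b)))"
    by (simp add: d_def inner_diff_right inner_commute algebra_simps)
  moreover have "s * (w \<bullet> (G a - G b)) = 2 * ((N (G a - G b))\<^sup>2 / (2 * L))"
    by (simp add: w(1) s_def power2_eq_square)
  moreover have "L * s\<^sup>2 / 2 = (N (G a - G b))\<^sup>2 / (2 * L)"
    using \<open>0 < L\<close> by (simp add: s_def power2_eq_square)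
  ultimately show ?thesis
    using upper lower by linarith
qed

section \<open>Accelerated mirror descent\<close>

text \<open>Substituting for \<open>y\<close> turns the update of \<open>x\<close> into a convex combination, which keeps the
  iterates in \<open>X\<close>.\<close>

lemma AMD_update_convex:
  assumes "AMD_trajectory g chi h \<gamma> x y \<zeta>"
  shows "y k = (1 - 1 / \<gamma> k) *\<^sub>R x k + (1 / \<gamma> k) *\<^sub>R chi (\<zeta> k)"
    and "x (Suc k) = (1 - 1 / \<gamma> k) *\<^sub>R x k + (1 / \<gamma> k) *\<^sub>R chi (\<zeta> (Suc k))"
proof -
  have y: "y k = x k + (1 / \<gamma> k) *\<^sub>R (chi (\<zeta> k) - x k)"
    and x: "x (Suc k) = y k + (1 / \<gamma> k) *\<^sub>R (chi (\<zeta> (Suc k)) - chi (\<zeta> k))"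
    using assms unfolding AMD_trajectory_def by blast+
  show "y k = (1 - 1 / \<gamma> k) *\<^sub>R x k + (1 / \<gamma> k) *\<^sub>R chi (\<zeta> k)"
    unfolding y by (simp add: algebra_simps)
  show "x (Suc k) = (1 - 1 / \<gamma> k) *\<^sub>R x k + (1 / \<gamma> k) *\<^sub>R chi (\<zeta> (Suc k))"
    unfolding x y by (simp add: algebra_simps)
qed

lemma AMD_in_convex_set:
  assumes amd: "AMD_trajectory g chi h \<gamma> x y \<zeta>"
    and "convex X" "range chi \<subseteq> X" "x 0 \<in> X" "\<And>k. \<gamma> k \<ge> 1"
  shows "x k \<in> X" and "y k \<in> X"
proof -
  have combination: "(1 - 1 / \<gamma> k) *\<^sub>R u + (1 / \<gamma> k) *\<^sub>R chi \<xi> \<in> X" if "u \<in> X" for k u \<xi>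
  proof -
    have "0 \<le> 1 / \<gamma> k" "1 / \<gamma> k \<le> 1"
      using assms(5)[of k] by (auto simp: field_simps)
    moreover have "chi \<xi> \<in> X"
      using assms(3) by blast
    ultimately show ?thesis
      using \<open>convex X\<close> that unfolding convex_alt by blast
  qed
  show x: "x k \<in> X"
    by (induction k) (simp_all add: assms(4) AMD_update_convex(2)[OF amd] combination)
  show "y k \<in> X"
    using combination[OF x] by (simp add: AMD_update_convex(1)[OF amd])
qed

text \<open>The gradient at \<open>y\<close>, paired with the displacement of the mirror point from a reference
  point \<open>p\<close>, controls the objective at three points at once. The displacement is a
  nonnegative combination of \<open>x' - y\<close>, \<open>y - x\<close> and \<open>y - p\<close>; the last three hypotheses are the
  descent inequality for the first and tangent inequalities for the other two.\<close>

lemma linear_coupling_bound: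
  fixes g x x' y z z' p :: "'a::real_inner" and \<gamma> fx fx' fy fp q :: real
  assumes \<gamma>: "\<gamma> \<ge> 1"
    and x': "x' = (1 - 1 / \<gamma>) *\<^sub>R x + (1 / \<gamma>) *\<^sub>R z'"
    and descent: "fx' \<le> fy + g \<bullet> (x' - y) + q / \<gamma>\<^sup>2"
    and at_x: "fy + g \<bullet> (x - y) \<le> fx"
    and at_p: "fy + g \<bullet> (p - y) \<le> fp"
  shows "\<gamma>\<^sup>2 * (fx' - fp) - (\<gamma>\<^sup>2 - \<gamma>) * (fx - fp) \<le> \<gamma> * (g \<bullet> (z' - p)) + q"
proof -
  have "\<gamma> *\<^sub>R x' = (\<gamma> - 1) *\<^sub>R x + z'"
    using \<gamma> by (simp add: x' scaleR_add_right right_diff_distrib)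
  then have z': "z' = \<gamma> *\<^sub>R x' - (\<gamma> - 1) *\<^sub>R x"
    by simp
  have split: "\<gamma> * (g \<bullet> (z' - p))
      = \<gamma>\<^sup>2 * (g \<bullet> (x' - y)) - (\<gamma>\<^sup>2 - \<gamma>) * (g \<bullet> (x - y)) - \<gamma> * (g \<bullet> (p - y))"
    unfolding z' by (simp add: inner_diff_right power2_eq_square algebra_simps)
  have "\<gamma>\<^sup>2 * fx' \<le> \<gamma>\<^sup>2 * (fy + g \<bullet> (x' - y) + q / \<gamma>\<^sup>2)"
    by (rule mult_left_mono[OF descent]) simp
  also have "\<dots> = \<gamma>\<^sup>2 * fy + \<gamma>\<^sup>2 * (g \<bullet> (x' - y)) + q"
    using \<gamma> by (simp add: distrib_left)
  finally have "\<gamma>\<^sup>2 * fx' \<le> \<gamma>\<^sup>2 * fy + \<gamma>\<^sup>2 * (g \<bullet> (x' - y)) + q" .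
  moreover have "(\<gamma>\<^sup>2 - \<gamma>) * (fy + g \<bullet> (x - y)) \<le> (\<gamma>\<^sup>2 - \<gamma>) * fx"
    by (rule mult_left_mono[OF at_x]) (use \<gamma> in \<open>simp add: power2_eq_square\<close>)
  moreover have "\<gamma> * (fy + g \<bullet> (p - y)) \<le> \<gamma> * fp"
    by (rule mult_left_mono[OF at_p]) (use \<gamma> in simp)
  ultimately show ?thesis
    unfolding split by (simp add: algebra_simps)
qed

theorem theorem2:
  fixes N :: "real ^ 'd \<Rightarrow> real"
    and X U :: "(real ^ 'd) set"
    and f \<psi> :: "real ^ 'd \<Rightarrow> real"
    and chi :: "real ^ 'd \<Rightarrow> real ^ 'd"
    and L_f L_chi h :: real
    and \<gamma> :: "nat \<Rightarrow> real"
    and x y \<zeta> :: "nat \<Rightarrow> real ^ 'd"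
    and xstar \<zeta>star :: "real ^ 'd"
  assumes "is_norm N"
    and "X \<noteq> {}" and "closed X" and "convex X"
    and "open U" and "X \<subseteq> U"
    and "convex_on U f"
    and "\<forall>u\<in>U. f differentiable (at u)" and "continuous_on U (grad f)"
    and "convex_on UNIV \<psi>" and "\<forall>\<xi>. \<psi> differentiable (at \<xi>)"
    and "chi = grad \<psi>"
    and "range chi \<subseteq> X"
    and "0 < L_chi"
    and "\<forall>\<xi> \<eta>. N (chi \<xi> - chi \<eta>) \<le> L_chi * dual_norm N (\<xi> - \<eta>)"
    and "\<gamma> 0 = 1" and "\<forall>k. \<gamma> k \<ge> 1"
    and "\<forall>k\<ge>1. (\<gamma> k)\<^sup>2 - (\<gamma> (k - 1))\<^sup>2 - \<gamma> k \<le> 0"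
    and "0 < L_f"
    and "\<forall>u\<in>U. \<forall>v\<in>U. dual_norm N (grad f u - grad f v) \<le> L_f * N (u - v)"
    and "0 < h" and "h \<le> 1 / (L_f * L_chi)"
    and "is_arg_min f (\<lambda>u. u \<in> X) xstar"
    and "chi \<zeta>star = xstar"
    and "x 0 \<in> X"
    and "AMD_trajectory (grad f) chi h \<gamma> x y \<zeta>"
  shows "(\<forall>k. lyapunov f \<psi> h \<gamma> xstar \<zeta>star (Suc k) (x (Suc k)) (\<zeta> (Suc k))
              \<le> lyapunov f \<psi> h \<gamma> xstar \<zeta>star k (x k) (\<zeta> k)) \<and>
         (\<forall>k. ((\<gamma> k)\<^sup>2 - \<gamma> k) * h * (f (x k) - f xstar) \<le> bregman \<psi> (\<zeta> 0) \<zeta>star)"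
proof -
  note N = assms(1) and conv_f = assms(7) and conv_\<psi> = assms(10) and chi = assms(12)
    and range_chi = assms(13) and amd = assms(26)
  have \<gamma>: "\<gamma> k \<ge> 1" for k
    using assms(17) by blast
  have "convex U"
    using conv_f by (rule convex_on_imp_convex)
  have Df: "GDERIV f u :> grad f u" if "u \<in> U" for u
    using assms(8) that by (intro GDERIV_grad) blast
  have D\<psi>: "GDERIV \<psi> \<xi> :> chi \<xi>" for \<xi>
    using assms(11) unfolding chi by (intro GDERIV_grad) blast
  have Lip: "N (chi \<xi> - chi \<eta>) \<le> L_chi * dual_norm N (\<xi> - \<eta>)" for \<xi> \<eta>
    using assms(15) by blast
  have scale: "N (a *\<^sub>R u) = \<bar>a\<bar> * N u" for a u
    using N unfolding is_norm_def by blast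
  have in_X: "x k \<in> X" "y k \<in> X" for k
    by (rule AMD_in_convex_set[OF amd assms(4) range_chi assms(25) \<gamma>])+
  have min: "xstar \<in> X" "f xstar \<le> f u" if "u \<in> X" for u
    using assms(23) that unfolding is_arg_min_def by (auto simp: not_less)
  have in_U: "x k \<in> U" "y k \<in> U" "xstar \<in> U" for k
    using in_X[of k] min(1)[OF in_X(1)] assms(6) by blast+

  have decrease: "lyapunov f \<psi> h \<gamma> xstar \<zeta>star (Suc k) (x (Suc k)) (\<zeta> (Suc k))
      \<le> lyapunov f \<psi> h \<gamma> xstar \<zeta>star k (x k) (\<zeta> k)" for k
  proof -
    let ?g = "grad f (y k)" and ?z = "chi (\<zeta> k)" and ?z' = "chi (\<zeta> (Suc k))"
    let ?Q = "(N (?z' - ?z))\<^sup>2"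
    let ?\<Delta> = "f (x (Suc k)) - f xstar"
    have "x (Suc k) - y k = (1 / \<gamma> k) *\<^sub>R (?z' - ?z)"
      using amd unfolding AMD_trajectory_def by simp
    then have "N (x (Suc k) - y k) = N (?z' - ?z) / \<gamma> k"
      using \<gamma>[of k] by (simp only: scale) simp
    then have "f (x (Suc k)) \<le> f (y k) + ?g \<bullet> (x (Suc k) - y k) + (L_f / 2 * ?Q) / (\<gamma> k)\<^sup>2"
      using descent_smooth[OF N \<open>convex U\<close> in_U(2)[of k] in_U(1)[of "Suc k"] Df, of L_f] assms(20)
      by (simp add: power_divide)
    then have "(\<gamma> k)\<^sup>2 * ?\<Delta> - ((\<gamma> k)\<^sup>2 - \<gamma> k) * (f (x k) - f xstar)
        \<le> \<gamma> k * (?g \<bullet> (?z' - xstar)) + L_f / 2 * ?Q"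
      by (rule linear_coupling_bound[OF \<gamma> AMD_update_convex(2)[OF amd]])
        (rule convex_on_above_tangent[OF conv_f assms(5)] in_U Df)+
    then have "h * ((\<gamma> k)\<^sup>2 * ?\<Delta> - ((\<gamma> k)\<^sup>2 - \<gamma> k) * (f (x k) - f xstar))
        \<le> h * (\<gamma> k * (?g \<bullet> (?z' - xstar)) + L_f / 2 * ?Q)"
      by (rule mult_left_mono) (use assms(21) in simp)
    then have primal: "(\<gamma> k)\<^sup>2 * h * ?\<Delta> - ((\<gamma> k)\<^sup>2 - \<gamma> k) * h * (f (x k) - f xstar)
        \<le> \<gamma> k * h * (?g \<bullet> (?z' - xstar)) + h * L_f / 2 * ?Q"
      by (simp add: algebra_simps)

    have step: "\<zeta> (Suc k) = \<zeta> k - (\<gamma> k * h) *\<^sub>R ?g"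
      using amd unfolding AMD_trajectory_def by blast
    have "\<psi> (\<zeta> (Suc k)) + ?z' \<bullet> (\<zeta> k - \<zeta> (Suc k)) + (N (?z - ?z'))\<^sup>2 / (2 * L_chi) \<le> \<psi> (\<zeta> k)"
      by (rule convex_Lipschitz_gradient_gap[OF N conv_\<psi> D\<psi> assms(14) Lip])
    moreover have "N (?z - ?z') = N (?z' - ?z)"
      using is_norm_minus[OF N, of "?z - ?z'"] by simp
    moreover have "?z' \<bullet> (\<zeta> k - \<zeta> (Suc k)) = \<gamma> k * h * (?g \<bullet> ?z')"
      by (simp add: step inner_commute)
    ultimately have gap: "\<psi> (\<zeta> (Suc k)) + \<gamma> k * h * (?g \<bullet> ?z') + ?Q / (2 * L_chi) \<le> \<psi> (\<zeta> k)"
      by simp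
    have "grad \<psi> \<zeta>star = xstar"
      using assms(24) by (simp add: chi)
    then have "bregman \<psi> (\<zeta> (Suc k)) \<zeta>star - bregman \<psi> (\<zeta> k) \<zeta>star
        = \<psi> (\<zeta> (Suc k)) - \<psi> (\<zeta> k) + \<gamma> k * h * (?g \<bullet> xstar)"
      by (simp add: bregman_def step inner_diff_left)
    with gap have dual: "bregman \<psi> (\<zeta> (Suc k)) \<zeta>star - bregman \<psi> (\<zeta> k) \<zeta>star
        \<le> - (\<gamma> k * h * (?g \<bullet> (?z' - xstar))) - ?Q / (2 * L_chi)"
      by (simp add: inner_diff_right right_diff_distrib)

    have "h * L_f / 2 \<le> 1 / (2 * L_chi)"
      using assms(14,19,22) by (simp add: field_simps)
    then have "h * L_f / 2 * ?Q \<le> 1 / (2 * L_chi) * ?Q"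
      by (rule mult_right_mono) simp
    then have balance: "h * L_f / 2 * ?Q \<le> ?Q / (2 * L_chi)"
      by simp
    have "(\<gamma> (Suc k))\<^sup>2 - (\<gamma> k)\<^sup>2 - \<gamma> (Suc k) \<le> 0"
      using assms(18)[rule_format, of "Suc k"] by simp
    then have "(\<gamma> (Suc k))\<^sup>2 - \<gamma> (Suc k) \<le> (\<gamma> k)\<^sup>2"
      by linarith
    moreover have "0 \<le> h * ?\<Delta>"
      using min(2)[OF in_X(1)[of "Suc k"]] assms(21) by simp
    ultimately have "((\<gamma> (Suc k))\<^sup>2 - \<gamma> (Suc k)) * (h * ?\<Delta>) \<le> (\<gamma> k)\<^sup>2 * (h * ?\<Delta>)"
      by (rule mult_right_mono)
    then have weights: "((\<gamma> (Suc k))\<^sup>2 - \<gamma> (Suc k)) * h * ?\<Delta> \<le> (\<gamma> k)\<^sup>2 * h * ?\<Delta>"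
      by (simp only: mult.assoc)
    show ?thesis
      unfolding lyapunov_def using primal dual balance weights by linarith
  qed

  have "((\<gamma> k)\<^sup>2 - \<gamma> k) * h * (f (x k) - f xstar) \<le> bregman \<psi> (\<zeta> 0) \<zeta>star" for k
  proof -
    have "lyapunov f \<psi> h \<gamma> xstar \<zeta>star k (x k) (\<zeta> k) \<le> lyapunov f \<psi> h \<gamma> xstar \<zeta>star 0 (x 0) (\<zeta> 0)"
      by (rule lift_Suc_antimono_le[where f = "\<lambda>k. lyapunov f \<psi> h \<gamma> xstar \<zeta>star k (x k) (\<zeta> k)"])
        (use decrease in auto)
    \<comment> \<open>The weight \<open>(\<gamma> 0)\<^sup>2 - \<gamma> 0\<close> of the initial objective gap vanishes.\<close>
    also have "\<dots> = bregman \<psi> (\<zeta> 0) \<zeta>star"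
      using assms(16) by (simp add: lyapunov_def)
    finally have "lyapunov f \<psi> h \<gamma> xstar \<zeta>star k (x k) (\<zeta> k) \<le> bregman \<psi> (\<zeta> 0) \<zeta>star" .
    moreover have "0 \<le> bregman \<psi> (\<zeta> k) \<zeta>star"
      using convex_on_above_tangent[OF conv_\<psi> open_UNIV _ _ D\<psi>, of \<zeta>star "\<zeta> k"]
      by (simp add: bregman_def chi inner_commute)
    ultimately show ?thesis
      by (simp add: lyapunov_def)
  qed
  with decrease show ?thesis
    by blast
qed

end
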